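(* Let $n\ge 3$, let $W_{\mathrm{aff}}$ be the affine Weyl group of type $A_{n-1}^{(1)}$, let $w\in W_{\mathrm{aff}}$ and let $\mathbf d=(d_0,\dots,d_{n-1})\in\mathbb Z_{\ge 0}^n$ be any degree. Then $$\Gamma_{\mathbf d}(w)=\max\{\,w\cdot u : u\in\Gamma_{\mathbf d}(id)\,\},$$ where $\cdot$ is the Hecke product and $\max$ of a set denotes its subset of maximal elements in the Bruhat order.
   Context: Roots. Let $n\ge 3$. Let $\alpha_0,\dots,\alpha_{n-1}$ (indices mod $n$) be the affine simple roots of type $A_{n-1}^{(1)}$, $Q_{\mathrm{aff}}=\bigoplus_{i=0}^{n-1}\mathbb Z\alpha_i$, with symmetric form $\langle\alpha_i,\alpha_i\rangle=2$, $\langle\alpha_i,\alpha_{i\pm1}\rangle=-1$, all other $\langle\alpha_i,\alpha_j\rangle=0$. Put $c=\sum_{i=0}^{n-1}\alpha_i$ (identified with the imaginary root $\delta$). Let $\Pi=\Pi^+\sqcup\Pi^-$ be the finite root system of type $A_{n-1}$ with simple roots $\alpha_1,\dots,\alpha_{n-1}$. The affine real roots are $\alpha+mc$ with $\alpha\in\Pi$, $m\in\mathbb Z$; such a root is positive if $m>0$, or $m=0$ and $\alpha\in\Pi^+$. The set of positive real roots is $\Pi_{\mathrm{aff}}^{\mathrm{re},+}$. Weyl group. For a real root $\alpha$, $s_\alpha(\mu)=\mu-\langle\mu,\alpha\rangle\alpha$. $W_{\mathrm{aff}}$ is the group generated by $s_i=s_{\alpha_i}$, $0\le i\le n-1$ (a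 Coxeter group with these generators), with length $\ell$ and Bruhat order $\le$. Hecke product: $u\cdot s_i=us_i$ if $\ell(us_i)>\ell(u)$ and $u\cdot s_i=u$ otherwise; $u\cdot v=u\cdot s_{i_1}\cdots s_{i_k}$ (applied left to right) for any reduced expression $v=s_{i_1}\cdots s_{i_k}$. This is a well-defined associative product. Curve neighborhoods. The moment graph has vertex set $W_{\mathrm{aff}}$ and an edge $u\stackrel{\alpha}{\longrightarrow}us_\alpha$ of degree $\alpha$ for each $u\in W_{\mathrm{aff}}$, $\alpha\in\Pi_{\mathrm{aff}}^{\mathrm{re},+}$. The degree of a chain (a succession of adjacent edges, possibly empty) is the sum of the degrees of its edges. A degree is a tuple $\mathbf d=(d_0,\dots,d_{n-1})\in\mathbb Z_{\ge0}^n$, identified with $\sum d_i\alpha_i$; degrees are ordered componentwise. For $u\in W_{\mathrm{aff}}$, $\Gamma_{\mathbf d}(u)$ is the set of Bruhat-maximal elements of the set of all $v\in W_{\mathrm{aff}}$ that can be joined to some $u'\le u$ by a chain of degree $\le\mathbf d$. *)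

theory Defs
  imports "HOL-Algebra.Generated_Groups" "HOL-Algebra.Bij"
begin

section \<open>The affine root lattice\<close>

text \<open>The element \<open>\<Sum>i<n. \<mu>\<^sub>i \<alpha>\<^sub>i\<close> of the root lattice is encoded by its coefficient function
  \<open>\<mu>\<close>, which vanishes from \<open>n\<close> on. Node indices are residues modulo \<open>n\<close>, represented by
  \<open>0, \<dots>, n - 1\<close>. All definitions are meant for \<open>n \<ge> 3\<close>.\<close>

type_synonym lattice_elt = "nat \<Rightarrow> int"

definition root_lattice :: "nat \<Rightarrow> lattice_elt set" where
  "root_lattice n = {\<mu>. \<forall>i\<ge>n. \<mu> i = 0}"

definition simple_root :: "nat \<Rightarrow> lattice_elt" where
  "simple_root i = (\<lambda>k. if k = i then 1 else 0)"

definition cartan :: "nat \<Rightarrow> nat \<Rightarrow> nat \<Rightarrow> int" where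
  "cartan n i j =
     (if i = j then 2
      else if j = (i + 1) mod n \<or> i = (j + 1) mod n then -1
      else 0)"

definition form :: "nat \<Rightarrow> lattice_elt \<Rightarrow> lattice_elt \<Rightarrow> int" where
  "form n \<mu> \<nu> = (\<Sum>i<n. \<Sum>j<n. \<mu> i * \<nu> j * cartan n i j)"

definition imaginary_root :: "nat \<Rightarrow> lattice_elt" where
  "imaginary_root n = (\<lambda>k. \<Sum>i<n. simple_root i k)"

text \<open>The positive roots of the finite system of type \<open>A\<close> with simple roots
  \<open>\<alpha>\<^sub>1, \<dots>, \<alpha>\<^bsub>n-1\<^esub>\<close> are the sums of consecutive simple roots.\<close>

definition finite_pos_roots :: "nat \<Rightarrow> lattice_elt set" where
  "finite_pos_roots n = {(\<lambda>k. \<Sum>l=i..j. simple_root l k) | i j. 1 \<le> i \<and> i \<le> j \<and> j \<le> n - 1}"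

definition finite_neg_roots :: "nat \<Rightarrow> lattice_elt set" where
  "finite_neg_roots n = {(\<lambda>k. - \<alpha> k) | \<alpha>. \<alpha> \<in> finite_pos_roots n}"

definition finite_roots :: "nat \<Rightarrow> lattice_elt set" where
  "finite_roots n = finite_pos_roots n \<union> finite_neg_roots n"

definition pos_real_roots :: "nat \<Rightarrow> lattice_elt set" where
  "pos_real_roots n =
     {(\<lambda>k. \<alpha> k + m * imaginary_root n k) | \<alpha> m.
        (\<alpha> \<in> finite_roots n \<and> m > 0) \<or> (\<alpha> \<in> finite_pos_roots n \<and> m = 0)}"

section \<open>The affine Weyl group\<close>

definition reflection :: "nat \<Rightarrow> lattice_elt \<Rightarrow> lattice_elt \<Rightarrow> lattice_elt" where
  "reflection n \<alpha> = (\<lambda>\<mu>\<in>root_lattice n. (\<lambda>k. \<mu> k - form n \<mu> \<alpha> * \<alpha> k))"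

definition simple_reflection :: "nat \<Rightarrow> nat \<Rightarrow> lattice_elt \<Rightarrow> lattice_elt" where
  "simple_reflection n i = reflection n (simple_root i)"

text \<open>The Weyl group acts on the affine root lattice from the left, so \<open>u \<otimes> v\<close> is
  \<open>u\<close> after \<open>v\<close>. The action is faithful, hence the abstract group is this group of bijections.\<close>

definition weyl_group :: "nat \<Rightarrow> (lattice_elt \<Rightarrow> lattice_elt) monoid" where
  "weyl_group n =
     (BijGroup (root_lattice n))
       \<lparr>carrier := generate (BijGroup (root_lattice n)) (simple_reflection n ` {..<n})\<rparr>"

definition word_prod :: "nat \<Rightarrow> nat list \<Rightarrow> lattice_elt \<Rightarrow> lattice_elt" where
  "word_prod n is =
     foldr (\<lambda>i v. simple_reflection n i \<otimes>\<^bsub>weyl_group n\<^esub> v) is \<one>\<^bsub>weyl_group n\<^esub>"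

definition weyl_length :: "nat \<Rightarrow> (lattice_elt \<Rightarrow> lattice_elt) \<Rightarrow> nat" where
  "weyl_length n w = (LEAST k. \<exists>is. set is \<subseteq> {..<n} \<and> word_prod n is = w \<and> length is = k)"

definition reduced_expression :: "nat \<Rightarrow> (lattice_elt \<Rightarrow> lattice_elt) \<Rightarrow> nat list \<Rightarrow> bool" where
  "reduced_expression n w is \<longleftrightarrow>
     set is \<subseteq> {..<n} \<and> word_prod n is = w \<and> length is = weyl_length n w"

definition coxeter_reflections :: "nat \<Rightarrow> (lattice_elt \<Rightarrow> lattice_elt) set" where
  "coxeter_reflections n =
     {w \<otimes>\<^bsub>weyl_group n\<^esub> simple_reflection n i \<otimes>\<^bsub>weyl_group n\<^esub> inv\<^bsub>weyl_group n\<^esub> w | w i.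
        w \<in> carrier (weyl_group n) \<and> i < n}"

definition bruhat_step ::
    "nat \<Rightarrow> (lattice_elt \<Rightarrow> lattice_elt) \<Rightarrow> (lattice_elt \<Rightarrow> lattice_elt) \<Rightarrow> bool" where
  "bruhat_step n u v \<longleftrightarrow>
     u \<in> carrier (weyl_group n) \<and>
     (\<exists>t\<in>coxeter_reflections n. v = u \<otimes>\<^bsub>weyl_group n\<^esub> t) \<and>
     weyl_length n u < weyl_length n v"

definition bruhat_le ::
    "nat \<Rightarrow> (lattice_elt \<Rightarrow> lattice_elt) \<Rightarrow> (lattice_elt \<Rightarrow> lattice_elt) \<Rightarrow> bool" where
  "bruhat_le n = (bruhat_step n)\<^sup>*\<^sup>*"

definition bruhat_max ::
    "nat \<Rightarrow> (lattice_elt \<Rightarrow> lattice_elt) set \<Rightarrow> (lattice_elt \<Rightarrow> lattice_elt) set" where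
  "bruhat_max n X = {v \<in> X. \<forall>x\<in>X. bruhat_le n v x \<longrightarrow> x = v}"

definition hecke_simple ::
    "nat \<Rightarrow> (lattice_elt \<Rightarrow> lattice_elt) \<Rightarrow> nat \<Rightarrow> (lattice_elt \<Rightarrow> lattice_elt)" where
  "hecke_simple n u i =
     (let v = u \<otimes>\<^bsub>weyl_group n\<^esub> simple_reflection n i
      in if weyl_length n v > weyl_length n u then v else u)"

text \<open>The Hecke product does not depend on the reduced expression chosen here.\<close>

definition hecke ::
    "nat \<Rightarrow> (lattice_elt \<Rightarrow> lattice_elt) \<Rightarrow> (lattice_elt \<Rightarrow> lattice_elt) \<Rightarrow> (lattice_elt \<Rightarrow> lattice_elt)" where
  "hecke n u v = foldl (hecke_simple n) u (SOME is. reduced_expression n v is)"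

section \<open>Curve neighborhoods\<close>

definition moment_edge ::
    "nat \<Rightarrow> (lattice_elt \<Rightarrow> lattice_elt) \<Rightarrow> lattice_elt \<Rightarrow> (lattice_elt \<Rightarrow> lattice_elt) \<Rightarrow> bool" where
  "moment_edge n u \<alpha> v \<longleftrightarrow>
     u \<in> carrier (weyl_group n) \<and> \<alpha> \<in> pos_real_roots n \<and> v = u \<otimes>\<^bsub>weyl_group n\<^esub> reflection n \<alpha>"

text \<open>\<open>moment_chain n u v \<beta>\<close>: some chain of degree \<open>\<beta>\<close> joins \<open>u\<close> to \<open>v\<close>. Reflections being
  involutions, edges can be traversed both ways, with the same degree.\<close>

inductive moment_chain ::
    "nat \<Rightarrow> (lattice_elt \<Rightarrow> lattice_elt) \<Rightarrow> (lattice_elt \<Rightarrow> lattice_elt) \<Rightarrow> lattice_elt \<Rightarrow> bool"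
  for n where
  empty: "u \<in> carrier (weyl_group n) \<Longrightarrow> moment_chain n u u (\<lambda>_. 0)"
| snoc: "moment_chain n u v \<beta> \<Longrightarrow> moment_edge n v \<alpha> v' \<Longrightarrow>
           moment_chain n u v' (\<lambda>k. \<beta> k + \<alpha> k)"

definition degrees :: "nat \<Rightarrow> lattice_elt set" where
  "degrees n = {d \<in> root_lattice n. \<forall>i<n. 0 \<le> d i}"

definition curve_nbhd ::
    "nat \<Rightarrow> lattice_elt \<Rightarrow> (lattice_elt \<Rightarrow> lattice_elt) \<Rightarrow> (lattice_elt \<Rightarrow> lattice_elt) set" where
  "curve_nbhd n d u =
     bruhat_max n
       {v \<in> carrier (weyl_group n).
          \<exists>u'\<in>carrier (weyl_group n). bruhat_le n u' u \<and>
            (\<exists>\<beta>. moment_chain n u' v \<beta> \<and> (\<forall>i<n. \<beta> i \<le> d i))}"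

end

theory Submission
  imports Defs
begin

text \<open>Left translation by \<open>x\<close> preserves the degree of a chain, so the elements reachable from some
  \<open>u' \<le> w\<close> are exactly the products \<open>u' z\<close> with \<open>u' \<le> w\<close> and \<open>z\<close> reachable from the identity.
  Two facts about the Hecke product then suffice: \<open>u' z \<le> w \<cdot> v\<close> whenever \<open>u' \<le> w\<close> and \<open>z \<le> v\<close>,
  and \<open>w \<cdot> v = x v\<close> for some \<open>x \<le> w\<close>. Hence the elements \<open>w \<cdot> v\<close>, with \<open>v\<close> maximal among those
  reachable from the identity, are themselves reachable and are cofinal. Both facts rest on
  the criterion that \<open>w s\<^sub>\<beta>\<close> is longer than \<open>w\<close> iff the root \<open>w \<beta>\<close> is positive.\<close>

section \<open>The Cartan form as a sum over the cycle of nodes\<close>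

text \<open>As \<open>n \<ge> 3\<close>, the two neighbours of a node are distinct, so each Cartan
  entry splits into three indicators, and these collapse the inner sums.\<close>

lemma form_eq_sums:
  assumes n: "3 \<le> n"
  shows "form n \<mu> \<nu> = 2 * (\<Sum>i<n. \<mu> i * \<nu> i)
    - (\<Sum>i<n. \<mu> i * \<nu> ((i+1) mod n)) - (\<Sum>i<n. \<mu> ((i+1) mod n) * \<nu> i)"
proof -
  have c: "cartan n i j = (if j = i then 2 else 0) - (if j = (i+1) mod n then 1 else 0)
      - (if i = (j+1) mod n then 1 else 0)" if "i < n" "j < n" for i j
    using that n by (cases "i + 1 = n"; cases "j + 1 = n") (auto simp: cartan_def)
  have "form n \<mu> \<nu> = (\<Sum>i<n. \<Sum>j<n. (if j = i then 2 * (\<mu> i * \<nu> j) else 0)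
      - (if j = (i+1) mod n then \<mu> i * \<nu> j else 0)
      - (if i = (j+1) mod n then \<mu> i * \<nu> j else 0))"
    unfolding form_def by (intro sum.cong refl) (simp add: c)
  also have "\<dots> = (\<Sum>i<n. \<Sum>j<n. if j = i then 2 * (\<mu> i * \<nu> j) else 0)
      - (\<Sum>i<n. \<Sum>j<n. if j = (i+1) mod n then \<mu> i * \<nu> j else 0)
      - (\<Sum>j<n. \<Sum>i<n. if i = (j+1) mod n then \<mu> i * \<nu> j else 0)"
    unfolding sum_subtractf
    by (subst (3) sum.swap) simp
  also have "\<dots> = 2 * (\<Sum>i<n. \<mu> i * \<nu> i)
    - (\<Sum>i<n. \<mu> i * \<nu> ((i+1) mod n)) - (\<Sum>i<n. \<mu> ((i+1) mod n) * \<nu> i)"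
    using n by (simp add: sum.delta sum_distrib_left)
  finally show ?thesis .
qed

lemma sum_cyclic_shift:
  fixes f :: "nat \<Rightarrow> 'a::comm_monoid_add"
  assumes "0 < n"
  shows "(\<Sum>i<n. f ((i+1) mod n)) = (\<Sum>i<n. f i)"
proof -
  obtain m where m: "n = Suc m" using assms by (cases n) auto
  have "(\<Sum>i<n. f ((i+1) mod n)) = (\<Sum>i<m. f (Suc i)) + f 0"
    by (simp add: m)
  also have "\<dots> = (\<Sum>i<n. f i)"
    unfolding m by (subst sum.lessThan_Suc_shift) (simp add: add.commute)
  finally show ?thesis .
qed

text \<open>Completing squares around the cycle shows that the form is positive semidefinite and
  that its null vectors in the lattice are the multiples of the imaginary root.\<close>

lemma form_self:
  assumes "3 \<le> n"
  shows "form n \<mu> \<mu> = (\<Sum>i<n. (\<mu> i - \<mu> ((i+1) mod n))\<^sup>2)"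
proof -
  have "(\<Sum>i<n. (\<mu> i - \<mu> ((i+1) mod n))\<^sup>2) =
     (\<Sum>i<n. (\<mu> i)\<^sup>2) + (\<Sum>i<n. (\<mu> ((i+1) mod n))\<^sup>2) - 2 * (\<Sum>i<n. \<mu> i * \<mu> ((i+1) mod n))"
    by (simp add: power2_diff sum_subtractf sum.distrib sum_distrib_left mult.assoc)
  also have "(\<Sum>i<n. (\<mu> ((i+1) mod n))\<^sup>2) = (\<Sum>i<n. (\<mu> i)\<^sup>2)"
    using sum_cyclic_shift[of n "\<lambda>i. (\<mu> i)\<^sup>2"] assms by simp
  finally show ?thesis
    by (simp add: form_eq_sums[OF assms] power2_eq_square mult.commute)
qed

lemma form_commute: "3 \<le> n \<Longrightarrow> form n \<mu> \<nu> = form n \<nu> \<mu>"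
  by (simp add: form_eq_sums mult.commute)

lemma form_add_scale_left:
  "form n (\<lambda>k. \<mu> k + c * \<nu> k) \<rho> = form n \<mu> \<rho> + c * form n \<nu> \<rho>"
  by (simp add: form_def distrib_right sum.distrib sum_distrib_left mult.assoc)

lemma form_add_scale_right:
  "form n \<rho> (\<lambda>k. \<mu> k + c * \<nu> k) = form n \<rho> \<mu> + c * form n \<rho> \<nu>"
  by (simp add: form_def distrib_right distrib_left sum.distrib sum_distrib_left mult.assoc
      mult.left_commute)

lemma form_simple_root:
  assumes "i < n"
  shows "form n (simple_root i) (simple_root i) = 2"
proof -
  have "form n (simple_root i) (simple_root i) =
     (\<Sum>k<n. if k = i then (\<Sum>j<n. if j = i then cartan n k j else 0) else 0)"
    unfolding form_def simple_root_def
    by (intro sum.cong refl) (simp add: if_distrib[of "\<lambda>x. x * _"] cong: if_cong)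
  also have "\<dots> = 2"
    using assms by (simp add: sum.delta cartan_def)
  finally show ?thesis .
qed

text \<open>The form is even and nonnegative, and it vanishes only if the coefficients agree all
  around the cycle.\<close>

lemma form_self_ge_2:
  assumes n: "3 \<le> n" and ab: "a < n" "b < n" "\<mu> a \<noteq> \<mu> b"
  shows "form n \<mu> \<mu> \<ge> 2"
proof -
  have "form n \<mu> \<mu> \<noteq> 0"
  proof
    assume "form n \<mu> \<mu> = 0"
    hence "(\<mu> i - \<mu> ((i+1) mod n))\<^sup>2 = 0" if "i < n" for i
      unfolding form_self[OF n]
      by (rule sum_nonneg_0[of "{..<n}", rotated 2]) (use that in simp_all)
    hence eq: "\<mu> i = \<mu> ((i+1) mod n)" if "i < n" for i
      using that by (metis power_eq_0_iff right_minus_eq)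
    have "\<mu> i = \<mu> 0" if "i < n" for i
      using that
    proof (induction i)
      case (Suc i)
      thus ?case using eq[of i] by simp
    qed simp
    thus False using ab by metis
  qed
  moreover have "form n \<mu> \<mu> \<ge> 0"
    unfolding form_self[OF n] by (simp add: sum_nonneg)
  moreover have "even (form n \<mu> \<mu>)"
    unfolding form_eq_sums[OF n] by (simp add: mult.commute)
  ultimately show ?thesis by presburger
qed

section \<open>Roots\<close>

text \<open>These are exactly the real roots. Taking them as the lattice vectors of norm 2 makes their
  invariance under the Weyl group immediate; only the sign dichotomy needs an argument.\<close>

definition roots :: "nat \<Rightarrow> lattice_elt set" where
  "roots n = {\<mu> \<in> root_lattice n. form n \<mu> \<mu> = 2}"

abbreviation nonneg :: "lattice_elt \<Rightarrow> bool" where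
  "nonneg \<mu> \<equiv> \<forall>k. 0 \<le> \<mu> k"

text \<open>If both signs occur, then the positive and the negative part each have norm at least 2,
  and their mutual pairing is at most 0, so the norm is at least 4.\<close>

lemma root_sign:
  assumes n: "3 \<le> n" and \<mu>: "\<mu> \<in> roots n" and a: "0 < \<mu> a"
  shows "nonneg \<mu>"
proof (rule ccontr)
  assume "\<not> nonneg \<mu>"
  then obtain b where b: "\<mu> b < 0" by (auto simp: not_le)
  have z: "\<mu> k = 0" if "n \<le> k" for k using \<mu> that by (simp add: roots_def root_lattice_def)
  have abn: "a < n" "b < n" using a b z by (metis less_irrefl not_less)+
  define p where "p = (\<lambda>k. max 0 (\<mu> k))"
  define q where "q = (\<lambda>k. max 0 (- \<mu> k))"
  have \<mu>pq: "\<mu> = (\<lambda>k. p k + (-1) * q k)"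
    by (auto simp: p_def q_def max_def)
  have "form n p p \<ge> 2"
    by (rule form_self_ge_2[OF n abn]) (use a b in \<open>auto simp: p_def\<close>)
  moreover have "form n q q \<ge> 2"
    by (rule form_self_ge_2[OF n abn]) (use a b in \<open>auto simp: q_def\<close>)
  moreover have "form n p q \<le> 0"
    unfolding form_def
  proof (intro sum_nonpos)
    fix i j
    show "p i * q j * cartan n i j \<le> 0"
    proof (cases "i = j")
      case False
      hence "cartan n i j \<le> 0" by (simp add: cartan_def)
      moreover have "0 \<le> p i * q j" by (simp add: p_def q_def)
      ultimately show ?thesis by (rule mult_nonneg_nonpos[rotated])
    qed (simp add: p_def q_def max_def)
  qed
  moreover have "form n \<mu> \<mu> = form n p p - 2 * form n p q + form n q q"
    unfolding \<mu>pq form_add_scale_left form_add_scale_right form_commute[OF n, of q p] by simp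
  ultimately show False using \<mu> by (simp add: roots_def)
qed

lemma root_nonzero:
  assumes "\<mu> \<in> roots n"
  obtains k where "k < n" "\<mu> k \<noteq> 0"
proof -
  have "\<exists>k<n. \<mu> k \<noteq> 0"
  proof (rule ccontr)
    assume "\<not> ?thesis"
    hence "form n \<mu> \<mu> = 0" by (simp add: form_def)
    thus False using assms by (simp add: roots_def)
  qed
  thus thesis using that by blast
qed

lemma roots_uminus: "\<mu> \<in> roots n \<Longrightarrow> (\<lambda>k. - \<mu> k) \<in> roots n"
  by (simp add: roots_def root_lattice_def form_def)

lemma root_neg_iff:
  assumes n: "3 \<le> n" and \<mu>: "\<mu> \<in> roots n"
  shows "nonneg (\<lambda>k. - \<mu> k) \<longleftrightarrow> \<not> nonneg \<mu>"
proof
  assume "nonneg (\<lambda>k. - \<mu> k)"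
  thus "\<not> nonneg \<mu>"
    using root_nonzero[OF \<mu>] by (metis neg_0_le_iff_le order_antisym)
next
  assume "\<not> nonneg \<mu>"
  then obtain k where "0 < - \<mu> k" by (auto simp: not_le)
  thus "nonneg (\<lambda>k. - \<mu> k)"
    by (rule root_sign[OF n roots_uminus[OF \<mu>]])
qed

lemma simple_root_in_roots: "i < n \<Longrightarrow> simple_root i \<in> roots n"
  using form_simple_root[of i n] by (simp add: roots_def root_lattice_def) (simp add: simple_root_def)

lemma simple_root_nonneg: "nonneg (simple_root i)"
  by (simp add: simple_root_def)

section \<open>Reflections\<close>

lemma reflection_apply:
  "\<mu> \<in> root_lattice n \<Longrightarrow> reflection n \<alpha> \<mu> = (\<lambda>k. \<mu> k + (- form n \<mu> \<alpha>) * \<alpha> k)"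
  by (simp add: reflection_def)

lemma reflection_uminus: "reflection n (\<lambda>k. - \<alpha> k) = reflection n \<alpha>"
proof -
  have "form n \<mu> (\<lambda>k. - \<alpha> k) = - form n \<mu> \<alpha>" for \<mu>
    by (simp add: form_def sum_negf)
  thus ?thesis by (simp add: reflection_def)
qed

lemma reflection_in_lattice:
  "\<alpha> \<in> root_lattice n \<Longrightarrow> \<mu> \<in> root_lattice n \<Longrightarrow> reflection n \<alpha> \<mu> \<in> root_lattice n"
  by (simp add: reflection_apply root_lattice_def)

lemma form_reflection:
  assumes n: "3 \<le> n" and "\<alpha> \<in> roots n" "\<mu> \<in> root_lattice n" "\<nu> \<in> root_lattice n"
  shows "form n (reflection n \<alpha> \<mu>) (reflection n \<alpha> \<nu>) = form n \<mu> \<nu>"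
  using assms
  by (simp only: reflection_apply form_add_scale_left form_add_scale_right)
    (simp add: roots_def form_commute[OF n, of \<alpha> \<nu>] algebra_simps)

lemma reflection_involutive:
  assumes "\<alpha> \<in> roots n" "\<mu> \<in> root_lattice n"
  shows "reflection n \<alpha> (reflection n \<alpha> \<mu>) = \<mu>"
proof -
  have \<alpha>: "\<alpha> \<in> root_lattice n" "form n \<alpha> \<alpha> = 2" using assms by (auto simp: roots_def)
  have "reflection n \<alpha> (reflection n \<alpha> \<mu>) =
     (\<lambda>k. reflection n \<alpha> \<mu> k + (- form n (reflection n \<alpha> \<mu>) \<alpha>) * \<alpha> k)"
    by (rule reflection_apply) (rule reflection_in_lattice[OF \<alpha>(1) assms(2)])
  also have "form n (reflection n \<alpha> \<mu>) \<alpha> = - form n \<mu> \<alpha>"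
    using \<alpha> assms(2) by (simp add: reflection_apply form_add_scale_left del: mult_minus_left)
  finally show ?thesis using assms(2) by (simp add: reflection_apply)
qed

lemma reflection_self:
  "\<alpha> \<in> roots n \<Longrightarrow> reflection n \<alpha> \<alpha> = (\<lambda>k. - \<alpha> k)"
  by (simp add: roots_def reflection_apply)

lemma reflection_in_Bij:
  assumes "\<alpha> \<in> roots n"
  shows "reflection n \<alpha> \<in> Bij (root_lattice n)"
proof -
  have "bij_betw (reflection n \<alpha>) (root_lattice n) (root_lattice n)"
    by (rule bij_betw_byWitness[where f' = "reflection n \<alpha>"])
      (use assms in \<open>auto simp: reflection_involutive roots_def intro: reflection_in_lattice\<close>)
  thus ?thesis by (simp add: Bij_def reflection_def)
qed

text \<open>The reflection changes only the coefficient at \<open>i\<close>. A positive root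
  supported at \<open>i\<close> alone is the simple root, because its norm is 2; any other one keeps
  a positive coefficient elsewhere, and \<open>root_sign\<close> spreads this sign to all
  coefficients of the image.\<close>

lemma simple_reflection_pos:
  assumes n: "3 \<le> n" and i: "i < n" and \<beta>: "\<beta> \<in> roots n" "nonneg \<beta>" "\<beta> \<noteq> simple_root i"
  shows "nonneg (simple_reflection n i \<beta>)"
proof -
  have L: "\<beta> \<in> root_lattice n" using \<beta> by (simp add: roots_def)
  have si: "simple_root i \<in> roots n" by (rule simple_root_in_roots[OF i])
  have R: "simple_reflection n i \<beta> \<in> roots n"
    using form_reflection[OF n si L L] reflection_in_lattice[OF _ L, of "simple_root i"] si \<beta>(1)
    by (simp add: simple_reflection_def roots_def)
  have "\<exists>j. j \<noteq> i \<and> \<beta> j \<noteq> 0"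
  proof (rule ccontr)
    assume "\<not> ?thesis"
    \<comment> \<open>The zero summand gives \<open>\<beta>\<close> the shape that the bilinearity
      lemmas expect.\<close>
    hence eq: "\<beta> = (\<lambda>k. 0 + \<beta> i * simple_root i k)" by (auto simp: simple_root_def fun_eq_iff)
    have "form n \<beta> \<beta> = \<beta> i * (\<beta> i * 2)"
      by (subst eq, subst (2) eq, simp only: form_add_scale_left form_add_scale_right
          form_simple_root[OF i]) (simp add: form_def)
    hence "\<beta> i * \<beta> i = 1" using \<beta>(1) by (simp add: roots_def)
    hence "\<beta> i = 1" using \<beta>(2) by (metis zmult_eq_1_iff neg_0_le_iff_le not_one_le_zero)
    thus False using eq \<beta>(3) by (auto simp: simple_root_def)
  qed
  then obtain j where "j \<noteq> i" "\<beta> j \<noteq> 0" by blast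
  hence "0 < simple_reflection n i \<beta> j"
    using L \<beta>(2) by (simp add: simple_reflection_def reflection_apply simple_root_def less_le)
  thus ?thesis by (rule root_sign[OF n R])
qed

section \<open>The Weyl group as a Coxeter group\<close>

locale affine_weyl_group =
  fixes n :: nat
  assumes n: "3 \<le> n"
begin

abbreviation L where "L \<equiv> root_lattice n"
abbreviation W where "W \<equiv> carrier (weyl_group n)"
abbreviation mult_weyl (infixl \<open>\<odot>\<close> 70) where "u \<odot> v \<equiv> u \<otimes>\<^bsub>weyl_group n\<^esub> v"
abbreviation one_weyl (\<open>e\<close>) where "e \<equiv> \<one>\<^bsub>weyl_group n\<^esub>"
abbreviation s where "s \<equiv> simple_reflection n"
abbreviation len where "len \<equiv> weyl_length n"
abbreviation bruhat_leq (infix \<open>\<preceq>\<close> 50) where "u \<preceq> v \<equiv> bruhat_le n u v"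

lemma s_in_Bij: "i < n \<Longrightarrow> s i \<in> Bij L"
  by (simp add: simple_reflection_def reflection_in_Bij simple_root_in_roots)

lemma subgroup_W: "subgroup W (BijGroup L)"
  unfolding weyl_group_def
  using group.generate_is_subgroup[OF group_BijGroup, of "s ` {..<n}" L] s_in_Bij
  by (auto simp: BijGroup_def)

sublocale weyl: group "weyl_group n"
proof -
  have "weyl_group n = BijGroup L \<lparr>carrier := W\<rparr>"
    by (simp add: weyl_group_def)
  thus "group (weyl_group n)"
    using subgroup.subgroup_is_group[OF subgroup_W group_BijGroup] by simp
qed

lemma W_Bij: "u \<in> W \<Longrightarrow> u \<in> Bij L"
  using subgroup.subset[OF subgroup_W] by (auto simp: BijGroup_def)

lemma W_extensional: "u \<in> W \<Longrightarrow> u \<in> extensional L"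
  using W_Bij by (auto simp: Bij_def)

lemma W_lattice: "u \<in> W \<Longrightarrow> \<mu> \<in> L \<Longrightarrow> u \<mu> \<in> L"
  using W_Bij bij_betwE by (fastforce simp: Bij_def)

lemma mult_BijGroup: "u \<odot> v = u \<otimes>\<^bsub>BijGroup L\<^esub> v"
  by (simp add: weyl_group_def)

lemma one_apply: "\<mu> \<in> L \<Longrightarrow> e \<mu> = \<mu>"
  by (simp add: weyl_group_def BijGroup_def)

lemma mult_apply: "u \<in> W \<Longrightarrow> v \<in> W \<Longrightarrow> \<mu> \<in> L \<Longrightarrow> (u \<odot> v) \<mu> = u (v \<mu>)"
  by (simp add: mult_BijGroup BijGroup_def W_Bij compose_eq)

lemma s_in_W: "i < n \<Longrightarrow> s i \<in> W"
  by (auto simp: weyl_group_def intro: generate.incl)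

lemma s_s: "i < n \<Longrightarrow> s i \<odot> s i = e"
  using reflection_involutive[OF simple_root_in_roots]
  by (intro extensionalityI[of _ L])
    (simp_all add: W_extensional s_in_W mult_apply one_apply flip: simple_reflection_def)

lemma inv_s: "i < n \<Longrightarrow> inv\<^bsub>weyl_group n\<^esub> (s i) = s i"
  by (rule weyl.inv_equality) (auto simp: s_s s_in_W)

lemma s_cancel: "u \<in> W \<Longrightarrow> i < n \<Longrightarrow> u \<odot> s i \<odot> s i = u"
  by (simp add: weyl.m_assoc s_in_W s_s)

lemma word_prod_Nil: "word_prod n [] = e"
  by (simp add: word_prod_def)

lemma word_prod_Cons: "word_prod n (i # is) = s i \<odot> word_prod n is"
  by (simp add: word_prod_def)

lemma word_prod_in_W: "set is \<subseteq> {..<n} \<Longrightarrow> word_prod n is \<in> W"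
  by (induction "is") (auto simp: word_prod_Nil word_prod_Cons s_in_W)

lemma word_prod_append:
  "set is \<subseteq> {..<n} \<Longrightarrow> set js \<subseteq> {..<n} \<Longrightarrow>
    word_prod n (is @ js) = word_prod n is \<odot> word_prod n js"
  by (induction "is") (auto simp: word_prod_Nil word_prod_Cons s_in_W word_prod_in_W weyl.m_assoc)

lemma word_prod_snoc:
  "set is \<subseteq> {..<n} \<Longrightarrow> i < n \<Longrightarrow> word_prod n (is @ [i]) = word_prod n is \<odot> s i"
  by (simp add: word_prod_append word_prod_Cons word_prod_Nil s_in_W)

text \<open>Words without inverse letters suffice because the generators are involutions.\<close>

lemma W_word:
  assumes "w \<in> W"
  obtains "is" where "set is \<subseteq> {..<n}" "w = word_prod n is"
proof -
  have "w \<in> generate (BijGroup L) (s ` {..<n})"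
    using assms by (simp add: weyl_group_def)
  hence "\<exists>is. set is \<subseteq> {..<n} \<and> w = word_prod n is"
  proof induction
    case one
    show ?case by (rule exI[of _ "[]"]) (simp add: word_prod_Nil weyl_group_def)
  next
    case (incl h)
    then obtain i where "i < n" "h = s i" by auto
    thus ?case by (intro exI[of _ "[i]"]) (simp add: word_prod_Nil word_prod_Cons s_in_W)
  next
    case (inv h)
    then obtain i where i: "i < n" "h = s i" by auto
    \<comment> \<open>The induction for \<open>generate\<close> takes inverses in the ambient group
      of bijections, so \<open>inv_s\<close> does not apply here.\<close>
    have "inv\<^bsub>BijGroup L\<^esub> (s i) = s i"
      using s_s[OF i(1)] s_in_Bij[OF i(1)]
      by (intro group.inv_equality[OF group_BijGroup])
        (auto simp: mult_BijGroup weyl_group_def BijGroup_def)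
    thus ?case using i
      by (intro exI[of _ "[i]"]) (simp add: word_prod_Nil word_prod_Cons s_in_W)
  next
    case (eng h1 h2)
    then obtain is1 is2 where "set is1 \<subseteq> {..<n}" "h1 = word_prod n is1"
      "set is2 \<subseteq> {..<n}" "h2 = word_prod n is2" by blast
    thus ?case
      by (intro exI[of _ "is1 @ is2"]) (simp add: word_prod_append mult_BijGroup)
  qed
  thus thesis using that by blast
qed

section \<open>Length and reduced words\<close>

lemma len_word_prod: "set is \<subseteq> {..<n} \<Longrightarrow> len (word_prod n is) \<le> length is"
  unfolding weyl_length_def by (rule Least_le) blast

lemma reduced_expression_exists:
  assumes "w \<in> W"
  obtains "is" where "reduced_expression n w is"
proof -
  obtain js where "set js \<subseteq> {..<n}" "w = word_prod n js" using W_word[OF assms] .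
  hence "\<exists>k is. set is \<subseteq> {..<n} \<and> word_prod n is = w \<and> length is = k" by blast
  hence "\<exists>is. set is \<subseteq> {..<n} \<and> word_prod n is = w \<and> length is = len w"
    unfolding weyl_length_def by (rule LeastI_ex)
  thus thesis using that by (auto simp: reduced_expression_def)
qed

lemma len_one: "len e = 0"
  using len_word_prod[of "[]"] by (simp add: word_prod_Nil)

lemma len_mult_s: "w \<in> W \<Longrightarrow> i < n \<Longrightarrow> len (w \<odot> s i) \<le> len w + 1"
proof -
  assume w: "w \<in> W" and i: "i < n"
  obtain "is" where "is": "reduced_expression n w is" using reduced_expression_exists[OF w] .
  thus ?thesis
    using len_word_prod[of "is @ [i]"] word_prod_snoc[of "is" i] i
    by (auto simp: reduced_expression_def)
qed

section \<open>The Weyl group acts by linear isometries\<close>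

lemma W_linear:
  assumes "w \<in> W" "\<mu> \<in> L" "\<nu> \<in> L"
  shows "w (\<lambda>k. \<mu> k + c * \<nu> k) = (\<lambda>k. w \<mu> k + c * w \<nu> k)"
proof -
  have lin: "(\<lambda>k. \<mu> k + c * \<nu> k) \<in> L" if "\<mu> \<in> L" "\<nu> \<in> L" for \<mu> \<nu> c
    using that by (simp add: root_lattice_def)
  have sl: "s i (\<lambda>k. \<mu> k + c * \<nu> k) = (\<lambda>k. s i \<mu> k + c * s i \<nu> k)"
    if "\<mu> \<in> L" "\<nu> \<in> L" for i \<mu> \<nu>
    using that lin[OF that]
    by (simp add: simple_reflection_def reflection_apply form_add_scale_left algebra_simps)
  obtain "is" where "is": "set is \<subseteq> {..<n}" "w = word_prod n is" using W_word[OF assms(1)] .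
  have "word_prod n is (\<lambda>k. \<mu> k + c * \<nu> k) =
      (\<lambda>k. word_prod n is \<mu> k + c * word_prod n is \<nu> k)"
    using "is"(1)
  proof (induction "is")
    case Nil
    show ?case using assms lin by (simp add: word_prod_Nil one_apply)
  next
    case (Cons i "is")
    thus ?case using assms lin
      by (simp add: word_prod_Cons mult_apply s_in_W word_prod_in_W sl W_lattice)
  qed
  thus ?thesis using "is"(2) by simp
qed

lemma W_form:
  assumes "w \<in> W" "\<mu> \<in> L" "\<nu> \<in> L"
  shows "form n (w \<mu>) (w \<nu>) = form n \<mu> \<nu>"
proof -
  obtain "is" where "is": "set is \<subseteq> {..<n}" "w = word_prod n is" using W_word[OF assms(1)] .
  have "form n (word_prod n is \<mu>) (word_prod n is \<nu>) = form n \<mu> \<nu>"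
    using "is"(1)
  proof (induction "is")
    case Nil
    show ?case using assms by (simp add: word_prod_Nil one_apply)
  next
    case (Cons i "is")
    thus ?case using assms n
      by (simp add: word_prod_Cons mult_apply s_in_W word_prod_in_W W_lattice)
        (simp add: simple_reflection_def form_reflection simple_root_in_roots word_prod_in_W W_lattice)
  qed
  thus ?thesis using "is"(2) by simp
qed

lemma W_roots: "w \<in> W \<Longrightarrow> \<beta> \<in> roots n \<Longrightarrow> w \<beta> \<in> roots n"
  by (simp add: roots_def W_form W_lattice)

lemma W_uminus:
  assumes "w \<in> W" "\<mu> \<in> L"
  shows "w (\<lambda>k. - \<mu> k) = (\<lambda>k. - w \<mu> k)"
  \<comment> \<open>Negation is the instance \<mu> - 2\<mu>.\<close>
  using W_linear[OF assms assms(2), of "-2"] by simp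

section \<open>Reflections, the exchange property and the length criterion\<close>

text \<open>A linear isometry carries the reflection in \<open>\<beta>\<close> to the reflection in
  its image. Membership of the reflection in \<open>W\<close> is a hypothesis, as
  \<open>roots n\<close> only records norm 2; in the applications the reflection is conjugate to a
  simple one.\<close>

lemma conj_reflection:
  assumes w: "w \<in> W" and \<beta>: "\<beta> \<in> roots n" "reflection n \<beta> \<in> W"
  shows "w \<odot> reflection n \<beta> \<odot> inv\<^bsub>weyl_group n\<^esub> w = reflection n (w \<beta>)"
proof (rule extensionalityI[of _ L])
  show "w \<odot> reflection n \<beta> \<odot> inv\<^bsub>weyl_group n\<^esub> w \<in> extensional L"
    using w \<beta> by (simp add: W_extensional)
  show "reflection n (w \<beta>) \<in> extensional L" by (simp add: reflection_def)
next
  fix \<mu> assume \<mu>: "\<mu> \<in> L"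
  define \<nu> where "\<nu> = (inv\<^bsub>weyl_group n\<^esub> w) \<mu>"
  have \<beta>L: "\<beta> \<in> L" using \<beta> by (simp add: roots_def)
  have \<nu>: "\<nu> \<in> L" using w \<mu> by (simp add: \<nu>_def W_lattice)
  have w\<nu>: "w \<nu> = \<mu>"
    using mult_apply[of w "inv\<^bsub>weyl_group n\<^esub> w" \<mu>] w \<mu> by (simp add: \<nu>_def one_apply)
  have "(w \<odot> reflection n \<beta> \<odot> inv\<^bsub>weyl_group n\<^esub> w) \<mu> = w (reflection n \<beta> \<nu>)"
    using w \<beta> \<mu> \<nu> by (simp add: mult_apply \<nu>_def[symmetric])
  also have "\<dots> = (\<lambda>k. w \<nu> k + (- form n \<nu> \<beta>) * w \<beta> k)"
    using W_linear[OF w \<nu> \<beta>L, of "- form n \<nu> \<beta>"] \<nu> by (simp only: reflection_apply)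
  also have "\<dots> = (\<lambda>k. \<mu> k + (- form n \<mu> (w \<beta>)) * w \<beta> k)"
    using W_form[OF w \<nu> \<beta>L] w\<nu> by simp
  also have "\<dots> = reflection n (w \<beta>) \<mu>"
    using \<mu> by (simp only: reflection_apply)
  finally show "(w \<odot> reflection n \<beta> \<odot> inv\<^bsub>weyl_group n\<^esub> w) \<mu> = reflection n (w \<beta>) \<mu>" .
qed

lemma mult_reflection:
  assumes w: "w \<in> W" and \<beta>: "\<beta> \<in> roots n" "reflection n \<beta> \<in> W"
  shows "reflection n (w \<beta>) \<in> W" "w \<odot> reflection n \<beta> = reflection n (w \<beta>) \<odot> w"
  using w \<beta> unfolding conj_reflection[OF assms, symmetric] by (simp_all add: weyl.m_assoc)

lemma reflection_square:
  assumes "\<beta> \<in> roots n" "reflection n \<beta> \<in> W"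
  shows "reflection n \<beta> \<odot> reflection n \<beta> = e"
  by (rule extensionalityI[of _ L])
    (use assms in \<open>auto simp: W_extensional mult_apply one_apply reflection_involutive\<close>)

text \<open>Let the letters act on \<open>\<beta>\<close> from the right end of the word. At some
  letter \<open>i\<close> a positive root turns negative, and by
  \<open>simple_reflection_pos\<close> that root is the simple root of \<open>i\<close>. Multiplying
  by the reflection then deletes this letter.\<close>

lemma strong_exchange:
  assumes \<beta>: "\<beta> \<in> roots n" "reflection n \<beta> \<in> W" "nonneg \<beta>"
    and "set is \<subseteq> {..<n}" "\<not> nonneg (word_prod n is \<beta>)"
  shows "\<exists>js. set js \<subseteq> {..<n} \<and> length js < length is \<and>
    word_prod n is \<odot> reflection n \<beta> = word_prod n js"
  using assms(4,5)
proof (induction "is")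
  case Nil
  thus ?case using \<beta> by (simp add: word_prod_Nil one_apply roots_def)
next
  case (Cons i "is")
  let ?w = "word_prod n is"
  have i: "i < n" and "is": "set is \<subseteq> {..<n}" using Cons.prems by auto
  have w: "?w \<in> W" using "is" by (rule word_prod_in_W)
  have \<beta>L: "\<beta> \<in> L" using \<beta> by (simp add: roots_def)
  show ?case
  proof (cases "nonneg (?w \<beta>)")
    case True
    have "\<not> nonneg (s i (?w \<beta>))"
      using Cons.prems i w \<beta>L by (simp add: word_prod_Cons mult_apply s_in_W)
    hence eq: "?w \<beta> = simple_root i"
      using simple_reflection_pos[OF n i W_roots[OF w \<beta>(1)] True] by blast
    \<comment> \<open>The sign changes at the leading letter: moved to the left of
      \<open>?w\<close>, the reflection becomes \<open>s i\<close> and cancels that letter.\<close>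
    have "word_prod n (i # is) \<odot> reflection n \<beta> = s i \<odot> (s i \<odot> ?w)"
      using i w \<beta> mult_reflection(2)[OF w \<beta>(1,2)] eq s_in_W[OF i]
      by (simp add: word_prod_Cons weyl.m_assoc flip: simple_reflection_def)
    also have "\<dots> = ?w"
      using i w by (simp add: s_in_W s_s flip: weyl.m_assoc)
    finally show ?thesis using "is" by (intro exI[of _ "is"]) simp
  next
    case False
    then obtain js where "set js \<subseteq> {..<n}" "length js < length is"
      "?w \<odot> reflection n \<beta> = word_prod n js" using Cons.IH "is" by blast
    thus ?thesis using i w \<beta>
      by (intro exI[of _ "i # js"]) (simp add: word_prod_Cons weyl.m_assoc s_in_W)
  qed
qed

lemma len_reflection_less:
  assumes w: "w \<in> W" and \<beta>: "\<beta> \<in> roots n" "reflection n \<beta> \<in> W" "nonneg \<beta>"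
    and "\<not> nonneg (w \<beta>)"
  shows "len (w \<odot> reflection n \<beta>) < len w"
proof -
  obtain "is" where "is": "reduced_expression n w is" using reduced_expression_exists[OF w] .
  then obtain js where "set js \<subseteq> {..<n}" "length js < length is"
    "w \<odot> reflection n \<beta> = word_prod n js"
    using strong_exchange[OF \<beta>, of "is"] assms(5) by (auto simp: reduced_expression_def)
  thus ?thesis using len_word_prod[of js] "is" by (simp add: reduced_expression_def)
qed

text \<open>One direction is \<open>len_reflection_less\<close>. For the other, apply the same lemma
  to the product with the reflection, which sends \<open>\<beta>\<close> to the negative of
  \<open>w \<beta>\<close>.\<close>

lemma len_reflection_greater_iff:
  assumes w: "w \<in> W" and \<beta>: "\<beta> \<in> roots n" "reflection n \<beta> \<in> W" "nonneg \<beta>"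
  shows "len w < len (w \<odot> reflection n \<beta>) \<longleftrightarrow> nonneg (w \<beta>)"
proof
  assume pos: "nonneg (w \<beta>)"
  let ?v = "w \<odot> reflection n \<beta>"
  have \<beta>L: "\<beta> \<in> L" using \<beta> by (simp add: roots_def)
  have v: "?v \<in> W" using w \<beta> by simp
  have "?v \<beta> = (\<lambda>k. - w \<beta> k)"
    using w \<beta> \<beta>L by (simp add: mult_apply reflection_self W_uminus)
  hence "\<not> nonneg (?v \<beta>)"
    using pos root_neg_iff[OF n W_roots[OF w \<beta>(1)]] by simp
  hence "len (?v \<odot> reflection n \<beta>) < len ?v" by (rule len_reflection_less[OF v \<beta>])
  moreover have "?v \<odot> reflection n \<beta> = w"
    using w \<beta> by (simp add: weyl.m_assoc reflection_square)
  ultimately show "len w < len ?v" by simp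
next
  assume "len w < len (w \<odot> reflection n \<beta>)"
  thus "nonneg (w \<beta>)" using len_reflection_less[OF w \<beta>] by fastforce
qed

lemma len_mult_s_iff:
  assumes "w \<in> W" "i < n"
  shows "len w < len (w \<odot> s i) \<longleftrightarrow> nonneg (w (simple_root i))"
    and "len (w \<odot> s i) < len w \<longleftrightarrow> \<not> nonneg (w (simple_root i))"
proof -
  have \<alpha>: "simple_root i \<in> roots n" "reflection n (simple_root i) \<in> W" "nonneg (simple_root i)"
    using assms s_in_W simple_root_in_roots simple_root_nonneg
    by (simp_all flip: simple_reflection_def)
  show *: "len w < len (w \<odot> s i) \<longleftrightarrow> nonneg (w (simple_root i))"
    unfolding simple_reflection_def by (rule len_reflection_greater_iff[OF assms(1) \<alpha>])
  show "len (w \<odot> s i) < len w \<longleftrightarrow> \<not> nonneg (w (simple_root i))"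
    using * len_reflection_less[OF assms(1) \<alpha>] unfolding simple_reflection_def
    by (metis less_asym)
qed

section \<open>Bruhat order and Hecke product\<close>

lemma coxeter_reflections_in_W: "t \<in> coxeter_reflections n \<Longrightarrow> t \<in> W"
  by (auto simp: coxeter_reflections_def s_in_W)

text \<open>Makes the length criterion applicable to Bruhat steps. The root can be taken positive
  since a root and its negative define the same reflection.\<close>

lemma coxeter_reflection_root:
  assumes "t \<in> coxeter_reflections n"
  obtains \<beta> where "\<beta> \<in> roots n" "nonneg \<beta>" "t = reflection n \<beta>"
proof -
  obtain w i where wi: "w \<in> W" "i < n" "t = w \<odot> s i \<odot> inv\<^bsub>weyl_group n\<^esub> w"
    using assms by (auto simp: coxeter_reflections_def)
  let ?\<beta> = "w (simple_root i)"
  have t: "t = reflection n ?\<beta>"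
    using wi conj_reflection[of w "simple_root i"] s_in_W[of i]
    by (simp add: simple_reflection_def simple_root_in_roots)
  have R: "?\<beta> \<in> roots n" using wi by (simp add: W_roots simple_root_in_roots)
  show thesis
  proof (cases "nonneg ?\<beta>")
    case True
    thus thesis using that R t by blast
  next
    case False
    thus thesis
      using that[of "\<lambda>k. - ?\<beta> k"] R t root_neg_iff[OF n R] by (simp add: roots_uminus reflection_uminus)
  qed
qed

lemma conj_coxeter_reflection:
  assumes "u \<in> W" "t \<in> coxeter_reflections n"
  shows "u \<odot> t \<odot> inv\<^bsub>weyl_group n\<^esub> u \<in> coxeter_reflections n"
proof -
  obtain w i where wi: "w \<in> W" "i < n" "t = w \<odot> s i \<odot> inv\<^bsub>weyl_group n\<^esub> w"
    using assms by (auto simp: coxeter_reflections_def)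
  hence "u \<odot> t \<odot> inv\<^bsub>weyl_group n\<^esub> u =
      (u \<odot> w) \<odot> s i \<odot> inv\<^bsub>weyl_group n\<^esub> (u \<odot> w)"
    using assms(1) by (simp add: weyl.m_assoc weyl.inv_mult_group s_in_W)
  thus ?thesis
    using wi assms(1) by (auto simp: coxeter_reflections_def)
qed

lemma s_coxeter: "i < n \<Longrightarrow> s i \<in> coxeter_reflections n"
  unfolding coxeter_reflections_def
  by (rule CollectI, rule exI[of _ e], rule exI[of _ i]) (simp add: s_in_W)

lemma bruhat_step_in_W: "bruhat_step n u v \<Longrightarrow> u \<in> W \<and> v \<in> W"
  by (auto simp: bruhat_step_def coxeter_reflections_in_W)

lemma bruhat_le_refl: "u \<preceq> u"
  by (simp add: bruhat_le_def)

lemma bruhat_le_trans: "u \<preceq> v \<Longrightarrow> v \<preceq> w \<Longrightarrow> u \<preceq> w"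
  by (simp add: bruhat_le_def)

lemma bruhat_step_le: "bruhat_step n u v \<Longrightarrow> u \<preceq> v"
  by (simp add: bruhat_le_def)

lemma bruhat_le_len: "u \<preceq> v \<Longrightarrow> u = v \<or> len u < len v"
  unfolding bruhat_le_def
  by (induction rule: rtranclp_induct) (auto simp: bruhat_step_def)

lemma bruhat_le_antisym: "u \<preceq> v \<Longrightarrow> v \<preceq> u \<Longrightarrow> u = v"
  using bruhat_le_len[of u v] bruhat_le_len[of v u] by auto

lemma bruhat_le_in_W: "u \<preceq> v \<Longrightarrow> v \<in> W \<Longrightarrow> u \<in> W"
  unfolding bruhat_le_def
  by (induction rule: converse_rtranclp_induct) (auto dest: bruhat_step_in_W)

lemma bruhat_le_one: "u \<preceq> e \<longleftrightarrow> u = e"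
  using bruhat_le_len[of u e] by (auto simp: len_one bruhat_le_refl)

section \<open>Right multiplication by a simple reflection in Bruhat order\<close>

text \<open>Conjugating the reflection by \<open>s i\<close> moves its root to
  \<open>s i \<beta>\<close>, which stays positive unless \<open>\<beta>\<close> is the simple root.
  Since \<open>u \<odot> s i\<close> sends the new root to \<open>u \<beta>\<close>, the length
  still increases.\<close>

lemma bruhat_step_mult_s:
  assumes st: "bruhat_step n u v" and i: "i < n"
  shows "u \<odot> s i = v \<or> bruhat_step n (u \<odot> s i) (v \<odot> s i)"
proof -
  obtain t where u: "u \<in> W" and t: "t \<in> coxeter_reflections n" and v: "v = u \<odot> t"
    and l: "len u < len v" using st by (auto simp: bruhat_step_def)
  obtain \<beta> where \<beta>: "\<beta> \<in> roots n" "nonneg \<beta>" "t = reflection n \<beta>"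
    using coxeter_reflection_root[OF t] .
  have tW: "t \<in> W" using t by (rule coxeter_reflections_in_W)
  have s: "s i \<in> W" using i by (rule s_in_W)
  have \<beta>L: "\<beta> \<in> L" using \<beta> by (simp add: roots_def)
  show ?thesis
  proof (cases "\<beta> = simple_root i")
    case True
    thus ?thesis using \<beta> v by (simp add: simple_reflection_def)
  next
    case False
    let ?t = "s i \<odot> t \<odot> inv\<^bsub>weyl_group n\<^esub> (s i)"
    let ?\<beta> = "s i \<beta>"
    have t': "?t = reflection n ?\<beta>"
      using conj_reflection[OF s \<beta>(1)] \<beta> tW by simp
    have T: "?t \<in> coxeter_reflections n" by (rule conj_coxeter_reflection[OF s t])
    have "(u \<odot> s i) ?\<beta> = u \<beta>"
      using u s \<beta>L i W_lattice[OF s \<beta>L]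
      by (simp add: mult_apply simple_reflection_def reflection_involutive simple_root_in_roots)
    moreover have "nonneg (u \<beta>)"
      using l v \<beta> tW len_reflection_greater_iff[OF u \<beta>(1) _ \<beta>(2)] by simp
    ultimately have "len (u \<odot> s i) < len (u \<odot> s i \<odot> ?t)"
      using len_reflection_greater_iff[of "u \<odot> s i" ?\<beta>] u s T t'
        W_roots[OF s \<beta>(1)] simple_reflection_pos[OF n i \<beta>(1,2) False]
        coxeter_reflections_in_W[OF T] by simp
    moreover have "u \<odot> s i \<odot> ?t = v \<odot> s i"
      using u s tW i
      by (simp add: v inv_s weyl.m_assoc)
        (simp add: s_s flip: weyl.m_assoc)
    ultimately show ?thesis
      using u s T unfolding bruhat_step_def by (metis weyl.m_closed)
  qed
qed

text \<open>The steps of a chain are translated one by one; where a translated step degenerates,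
  \<open>a \<odot> s i\<close> is the next element of the original chain and so lies below
  \<open>b\<close>.\<close>

lemma bruhat_le_mult_s:
  assumes "a \<preceq> b" "i < n"
  shows "a \<odot> s i \<preceq> b \<or> a \<odot> s i \<preceq> b \<odot> s i"
  using assms(1) unfolding bruhat_le_def
proof (induction rule: converse_rtranclp_induct)
  case (step a a')
  thus ?case using bruhat_step_mult_s[OF step(1) assms(2)]
    by (metis converse_rtranclp_into_rtranclp)
qed simp

text \<open>Translating a chain that ends at \<open>y \<odot> s i\<close> gives one ending at
  \<open>y\<close>. If a step degenerates, so that \<open>z \<odot> s i = z'\<close>, then
  \<open>z = z' \<odot> s i\<close> and the first alternative takes over.\<close>

lemma bruhat_le_mult_s_cases:
  assumes "z \<preceq> y \<odot> s i" "y \<in> W" "i < n"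
  shows "z \<preceq> y \<or> z \<odot> s i \<preceq> y"
  using assms(1) unfolding bruhat_le_def
proof (induction rule: converse_rtranclp_induct)
  case base
  thus ?case using assms by (simp add: s_cancel)
next
  case (step z z')
  have "z \<in> W" using step by (auto dest: bruhat_step_in_W)
  thus ?case using step bruhat_step_mult_s[OF step(1) assms(3)] assms(3) s_cancel
    by (metis converse_rtranclp_into_rtranclp)
qed

section \<open>Hecke products along words: upper bound and factorization\<close>

lemma hecke_simple_in_W: "w \<in> W \<Longrightarrow> i < n \<Longrightarrow> hecke_simple n w i \<in> W"
  by (simp add: hecke_simple_def Let_def s_in_W)

lemma hecke_simple_ge:
  assumes "w \<in> W" "i < n"
  shows "w \<preceq> hecke_simple n w i" "w \<odot> s i \<preceq> hecke_simple n w i"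
proof -
  have st: "bruhat_step n u (u \<odot> s i)" if "len u < len (u \<odot> s i)" "u \<in> W" for u
    using that s_coxeter[OF assms(2)] by (auto simp: bruhat_step_def)
  show "w \<preceq> hecke_simple n w i"
    using st[of w] assms by (auto simp: hecke_simple_def Let_def bruhat_le_refl bruhat_step_le)
  \<comment> \<open>If \<open>w \<odot> s i\<close> is not longer than \<open>w\<close>, the sign
    criterion makes it strictly shorter, so it has a Bruhat step up to \<open>w\<close>.\<close>
  show "w \<odot> s i \<preceq> hecke_simple n w i"
    using st[of "w \<odot> s i"] assms len_mult_s_iff[OF assms]
    by (auto simp: hecke_simple_def Let_def bruhat_le_refl s_in_W s_cancel intro!: bruhat_step_le)
qed

lemma hecke_simple_mono:
  assumes "a \<preceq> b" "b \<in> W" "i < n"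
  shows "a \<preceq> hecke_simple n b i" "a \<odot> s i \<preceq> hecke_simple n b i"
  using bruhat_le_mult_s[OF assms(1,3)] hecke_simple_ge[OF assms(2,3)] assms(1)
  by (blast intro: bruhat_le_trans)+

lemma hecke_word_in_W:
  "w \<in> W \<Longrightarrow> set is \<subseteq> {..<n} \<Longrightarrow> foldl (hecke_simple n) w is \<in> W"
  by (induction "is" arbitrary: w) (auto simp: hecke_simple_in_W)

text \<open>Induction on the last letter: one of \<open>z\<close> and \<open>z \<odot> s i\<close>
  lies below the shorter word, and \<open>hecke_simple_mono\<close> bounds
  \<open>u \<odot> z\<close> in both cases.\<close>

lemma mult_le_hecke_word:
  assumes "set is \<subseteq> {..<n}" "w \<in> W" "u \<preceq> w" "z \<preceq> word_prod n is"
  shows "u \<odot> z \<preceq> foldl (hecke_simple n) w is"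
  using assms(1,4)
proof (induction "is" arbitrary: z rule: rev_induct)
  case Nil
  have "u \<in> W" using assms bruhat_le_in_W by blast
  thus ?case using Nil assms by (simp add: word_prod_Nil bruhat_le_one)
next
  case (snoc i "is")
  let ?h = "foldl (hecke_simple n) w is"
  have i: "i < n" and "is": "set is \<subseteq> {..<n}" using snoc.prems by auto
  have uW: "u \<in> W" using assms bruhat_le_in_W by blast
  have zW: "z \<in> W" using snoc.prems word_prod_in_W bruhat_le_in_W by blast
  have h: "?h \<in> W" using "is" assms by (simp add: hecke_word_in_W)
  from snoc.prems have "z \<preceq> word_prod n is \<odot> s i"
    using "is" i by (simp add: word_prod_snoc)
  hence "z \<preceq> word_prod n is \<or> z \<odot> s i \<preceq> word_prod n is"
    using bruhat_le_mult_s_cases "is" i word_prod_in_W by blast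
  thus ?case
  proof
    assume "z \<preceq> word_prod n is"
    thus ?thesis using snoc.IH "is" hecke_simple_mono(1)[OF _ h i] by simp
  next
    assume "z \<odot> s i \<preceq> word_prod n is"
    hence "u \<odot> (z \<odot> s i) \<odot> s i \<preceq> hecke_simple n ?h i"
      using snoc.IH "is" hecke_simple_mono(2)[OF _ h i] by blast
    moreover have "u \<odot> (z \<odot> s i) \<odot> s i = u \<odot> z"
      using uW zW i s_cancel[of "u \<odot> z" i] by (simp add: weyl.m_assoc s_in_W)
    ultimately show ?thesis by simp
  qed
qed

text \<open>When the last letter of the word does not lengthen the product, it is absorbed into the
  left factor as a reflection, which can only move that factor down.\<close>

lemma hecke_word_factor:
  assumes "set is \<subseteq> {..<n}" "len (word_prod n is) = length is" "w \<in> W"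
  shows "\<exists>x\<in>W. x \<preceq> w \<and> foldl (hecke_simple n) w is = x \<odot> word_prod n is"
  using assms(1,2)
proof (induction "is" rule: rev_induct)
  case Nil
  thus ?case using assms(3) by (auto simp: word_prod_Nil bruhat_le_refl)
next
  case (snoc i "is")
  let ?y = "word_prod n is"
  have i: "i < n" and "is": "set is \<subseteq> {..<n}" using snoc.prems by auto
  have s: "s i \<in> W" using i by (rule s_in_W)
  have y: "?y \<in> W" using "is" by (rule word_prod_in_W)
  have ws: "word_prod n (is @ [i]) = ?y \<odot> s i" using "is" i by (rule word_prod_snoc)
  \<comment> \<open>A letter adds at most one to the length, so a prefix of a reduced word is
    reduced.\<close>
  have ly: "len ?y = length is"
    using len_mult_s[OF y i] len_word_prod[OF "is"] snoc.prems ws by simp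
  then obtain x where x: "x \<in> W" "x \<preceq> w" "foldl (hecke_simple n) w is = x \<odot> ?y"
    using snoc.IH "is" by blast
  show ?case
  proof (cases "len (x \<odot> ?y) < len (x \<odot> ?y \<odot> s i)")
    case True
    hence "foldl (hecke_simple n) w (is @ [i]) = x \<odot> word_prod n (is @ [i])"
      using x y s ws by (simp add: hecke_simple_def weyl.m_assoc)
    thus ?thesis using x by blast
  next
    case False
    \<comment> \<open>\<open>?t\<close> is the last letter moved to the left of \<open>?y\<close>.
      Its root \<open>?\<beta>\<close> is positive because the whole word is reduced, while
      \<open>x\<close> makes it negative because the product did not grow.\<close>
    let ?\<beta> = "?y (simple_root i)"
    let ?t = "?y \<odot> s i \<odot> inv\<^bsub>weyl_group n\<^esub> ?y"
    have si: "simple_root i \<in> L" "simple_root i \<in> roots n"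
      using simple_root_in_roots[OF i] by (auto simp: roots_def)
    have T: "?t \<in> coxeter_reflections n" using y i by (auto simp: coxeter_reflections_def)
    have tW: "?t \<in> W" using T by (rule coxeter_reflections_in_W)
    have t: "?t = reflection n ?\<beta>"
      using conj_reflection[OF y si(2)] s by (simp add: simple_reflection_def)
    have \<beta>: "nonneg ?\<beta>" "?\<beta> \<in> roots n"
      using len_mult_s_iff(1)[OF y i] ly ws snoc.prems y si by (simp_all add: W_roots)
    have "\<not> nonneg (x ?\<beta>)"
      using len_mult_s_iff(1)[of "x \<odot> ?y" i] False x y i si by (simp add: mult_apply)
    hence "len (x \<odot> ?t) < len x"
      using len_reflection_less[OF x(1) \<beta>(2) _ \<beta>(1)] t tW by simp
    moreover have tt: "?t \<odot> ?t = e" using reflection_square[OF \<beta>(2)] t tW by simp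
    hence "x \<odot> ?t \<odot> ?t = x" using x(1) tW by (simp add: weyl.m_assoc)
    ultimately have "bruhat_step n (x \<odot> ?t) x"
      using T tW x(1) unfolding bruhat_step_def by (metis weyl.m_closed)
    hence le: "x \<odot> ?t \<preceq> w" using x bruhat_step_le bruhat_le_trans by blast
    \<comment> \<open>\<open>?t \<odot> ?y = ?y \<odot> s i\<close>, so the appended letter cancels
      and the value of the Hecke product is unchanged.\<close>
    have "x \<odot> ?t \<odot> word_prod n (is @ [i]) = x \<odot> ?y"
      using x(1) y s i by (simp add: ws weyl.m_assoc) (simp add: weyl.inv_solve_left' s_s
          flip: weyl.m_assoc)
    moreover have "foldl (hecke_simple n) w (is @ [i]) = x \<odot> ?y"
      using x False by (simp add: hecke_simple_def)
    ultimately show ?thesis using le x(1) tW by (metis weyl.m_closed)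
  qed
qed

lemma reduced_expression_some:
  assumes "v \<in> W"
  shows "reduced_expression n v (SOME is. reduced_expression n v is)"
  using reduced_expression_exists[OF assms] by (metis someI)

lemma mult_le_hecke:
  assumes "u \<preceq> w" "w \<in> W" "z \<preceq> v" "v \<in> W"
  shows "u \<odot> z \<preceq> hecke n w v"
  using mult_le_hecke_word reduced_expression_some[OF assms(4)] assms
  by (simp add: hecke_def reduced_expression_def)

lemma hecke_factor:
  assumes "w \<in> W" "v \<in> W"
  obtains x where "x \<in> W" "x \<preceq> w" "hecke n w v = x \<odot> v"
  using hecke_word_factor[OF _ _ assms(1)] reduced_expression_some[OF assms(2)]
  by (metis hecke_def reduced_expression_def)

section \<open>Curve neighborhoods\<close>

lemma finite_pos_root_indicator:
  assumes "\<alpha> \<in> finite_pos_roots n"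
  obtains i j where "1 \<le> i" "i \<le> j" "j < n" "\<alpha> = (\<lambda>k. if i \<le> k \<and> k \<le> j then 1 else 0)"
proof -
  obtain i j where ij: "1 \<le> i" "i \<le> j" "j \<le> n - 1" "\<alpha> = (\<lambda>k. \<Sum>l=i..j. simple_root l k)"
    using assms by (auto simp: finite_pos_roots_def)
  have "\<alpha> = (\<lambda>k. if i \<le> k \<and> k \<le> j then 1 else 0)"
    unfolding ij(4) simple_root_def by (auto simp: sum.delta' fun_eq_iff)
  thus thesis using that[of i j] ij n by simp
qed

lemma finite_pos_roots_in_roots:
  assumes "\<alpha> \<in> finite_pos_roots n"
  shows "\<alpha> \<in> roots n"
proof -
  obtain i j where ij: "1 \<le> i" "i \<le> j" "j < n"
    and \<alpha>: "\<alpha> = (\<lambda>k. if i \<le> k \<and> k \<le> j then 1 else 0)"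
    using finite_pos_root_indicator[OF assms] .
  \<comment> \<open>The indicator of an interval jumps only on entering and on leaving it. Node 0
    lies outside since \<open>1 \<le> i\<close>, so the wrap-around at \<open>n - 1\<close> agrees
    with this count.\<close>
  have "(\<alpha> k - \<alpha> ((k+1) mod n))\<^sup>2 = (if k = i - 1 then 1 else 0) + (if k = j then 1 else 0)"
    if "k < n" for k
    using that ij by (cases "k + 1 = n") (auto simp: \<alpha>)
  hence "form n \<alpha> \<alpha> = (\<Sum>k<n. (if k = i - 1 then 1 else 0) + (if k = j then 1 else 0))"
    unfolding form_self[OF n] by (intro sum.cong) auto
  also have "\<dots> = 2" using ij by (simp add: sum.distrib sum.delta less_imp_diff_less)
  finally show ?thesis using ij by (auto simp: roots_def root_lattice_def \<alpha>)
qed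

lemma imaginary_root_eq: "imaginary_root n k = (if k < n then 1 else 0)"
  by (simp add: imaginary_root_def simple_root_def sum.delta')

text \<open>Adding a multiple of the imaginary root leaves the cyclic differences, hence the norm,
  unchanged. Finite roots have coefficients at least -1, which a positive multiple
  compensates.\<close>

lemma pos_real_roots_props:
  assumes "\<gamma> \<in> pos_real_roots n"
  shows "\<gamma> \<in> roots n" "nonneg \<gamma>"
proof -
  obtain \<alpha> m where \<gamma>: "\<gamma> = (\<lambda>k. \<alpha> k + m * imaginary_root n k)" and m: "0 \<le> m"
    and \<alpha>: "\<alpha> \<in> finite_pos_roots n \<or> \<alpha> \<in> finite_neg_roots n \<and> 0 < m"
    using assms by (auto simp: pos_real_roots_def finite_roots_def)
  have \<alpha>R: "\<alpha> \<in> roots n"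
    using \<alpha> finite_pos_roots_in_roots roots_uminus by (auto simp: finite_neg_roots_def)
  have "form n \<gamma> \<gamma> = form n \<alpha> \<alpha>"
    unfolding form_self[OF n] \<gamma> using n by (intro sum.cong) (simp_all add: imaginary_root_eq)
  thus "\<gamma> \<in> roots n"
    using \<alpha>R by (simp add: roots_def root_lattice_def \<gamma> imaginary_root_eq)
  show "nonneg \<gamma>"
  proof
    fix k
    have "0 \<le> \<alpha> k \<or> - 1 \<le> \<alpha> k \<and> 0 < m"
      using \<alpha> by (auto simp: finite_neg_roots_def elim!: finite_pos_root_indicator split: if_splits)
    moreover have "\<alpha> k = 0" if "n \<le> k"
      using \<alpha>R that by (simp add: roots_def root_lattice_def)
    ultimately show "0 \<le> \<gamma> k"
      using m by (cases "k < n") (auto simp: \<gamma> imaginary_root_eq)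
  qed
qed

section \<open>Translation and finiteness of chains\<close>

text \<open>Associativity is taken from the ambient group of bijections, since
  \<open>moment_edge\<close> does not state that the reflection lies in \<open>W\<close>.\<close>

lemma moment_edge_left_mult:
  assumes "moment_edge n u \<gamma> v" "x \<in> W"
  shows "moment_edge n (x \<odot> u) \<gamma> (x \<odot> v)"
proof -
  have "u \<in> Bij L" "x \<in> Bij L" "reflection n \<gamma> \<in> Bij L"
    using assms by (auto simp: moment_edge_def W_Bij reflection_in_Bij pos_real_roots_props)
  hence "x \<odot> (u \<odot> reflection n \<gamma>) = x \<odot> u \<odot> reflection n \<gamma>"
    using monoid.m_assoc[OF group.is_monoid[OF group_BijGroup], of x L u "reflection n \<gamma>"]
    unfolding mult_BijGroup by (simp add: BijGroup_def)
  thus ?thesis using assms by (simp add: moment_edge_def)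
qed

lemma moment_chain_left_mult:
  "moment_chain n u v \<beta> \<Longrightarrow> x \<in> W \<Longrightarrow> moment_chain n (x \<odot> u) (x \<odot> v) \<beta>"
  by (induction rule: moment_chain.induct)
    (auto intro: moment_chain.intros moment_edge_left_mult)

lemma moment_chain_nonneg: "moment_chain n u v \<beta> \<Longrightarrow> nonneg \<beta>"
  by (induction rule: moment_chain.induct) (auto simp: moment_edge_def pos_real_roots_props)

text \<open>Only finitely many roots fit under the bound, and each edge uses up at least one unit of
  height, so the number of edges is bounded too. Finiteness later places every reachable element
  below a maximal one.\<close>

lemma finite_chain_targets:
  "finite {v. \<exists>\<beta>. moment_chain n u v \<beta> \<and> (\<forall>i<n. \<beta> i \<le> d i)}"
proof -
  define R where "R = {\<gamma> \<in> pos_real_roots n. \<forall>i<n. \<gamma> i \<le> d i}"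
  \<comment> \<open>The sum of absolute values bounds every coefficient and also the total height,
    for \<open>d\<close> of any sign.\<close>
  define D where "D = (\<Sum>i<n. \<bar>d i\<bar>)"
  define S where "S k = {v. \<exists>\<beta>. moment_chain n u v \<beta> \<and> (\<forall>i<n. \<beta> i \<le> d i) \<and>
    (\<Sum>i<n. \<beta> i) \<le> int k}" for k
  have D: "d i \<le> D" if "i < n" for i
    using member_le_sum[of i "{..<n}" "\<lambda>i. \<bar>d i\<bar>"] that by (simp add: D_def)
  have "R \<subseteq> {\<gamma>. \<forall>i. (i \<in> {..<n} \<longrightarrow> \<gamma> i \<in> {0..D}) \<and> (i \<notin> {..<n} \<longrightarrow> \<gamma> i = 0)}"
  proof
    fix \<gamma> assume "\<gamma> \<in> R"
    hence "\<gamma> \<in> roots n" "nonneg \<gamma>" "\<forall>i<n. \<gamma> i \<le> D"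
      using pos_real_roots_props[of \<gamma>] by (auto simp: R_def intro: order_trans[OF _ D])
    thus "\<gamma> \<in> {\<gamma>. \<forall>i. (i \<in> {..<n} \<longrightarrow> \<gamma> i \<in> {0..D}) \<and> (i \<notin> {..<n} \<longrightarrow> \<gamma> i = 0)}"
      by (simp add: roots_def root_lattice_def)
  qed
  hence R: "finite R"
    by (rule finite_subset) (rule finite_set_of_finite_funs; simp)
  \<comment> \<open>Splitting off the last edge lowers the height by at least one, since a positive
    root has a positive coefficient. At height 0 only the empty chain remains.\<close>
  have step: "S k \<subseteq> {u} \<union> (\<Union>\<gamma>\<in>R. (\<lambda>v. v \<odot> reflection n \<gamma>) ` S (k - 1))"
    and zero: "S 0 \<subseteq> {u}" for k
  proof -
    have *: "v = u \<or> 0 < k \<and> (\<exists>\<gamma>\<in>R. \<exists>v'\<in>S (k - 1). v = v' \<odot> reflection n \<gamma>)"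
      if v: "v \<in> S k" for v k
    proof -
      obtain \<beta> where \<beta>: "moment_chain n u v \<beta>" "\<forall>i<n. \<beta> i \<le> d i" "(\<Sum>i<n. \<beta> i) \<le> int k"
        using v by (auto simp: S_def)
      from \<beta>(1) show ?thesis
      proof cases
        case (snoc v' \<beta>' \<gamma>)
        hence \<gamma>: "\<gamma> \<in> pos_real_roots n" and v': "v = v' \<odot> reflection n \<gamma>"
          by (auto simp: moment_edge_def)
        have nn: "nonneg \<beta>'" using snoc moment_chain_nonneg by blast
        obtain j where j: "j < n" "\<gamma> j \<noteq> 0"
          using root_nonzero[OF pos_real_roots_props(1)[OF \<gamma>]] .
        have "0 \<le> \<gamma> j" using pos_real_roots_props(2)[OF \<gamma>] by blast
        hence "1 \<le> \<gamma> j" using j by linarith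
        also have "\<gamma> j \<le> (\<Sum>i<n. \<gamma> i)"
          using j pos_real_roots_props(2)[OF \<gamma>] by (intro member_le_sum) auto
        finally have g: "1 \<le> (\<Sum>i<n. \<gamma> i)" .
        have sum: "(\<Sum>i<n. \<beta>' i) + (\<Sum>i<n. \<gamma> i) \<le> int k"
          using \<beta>(3) snoc by (simp add: sum.distrib)
        have "0 \<le> (\<Sum>i<n. \<beta>' i)" using nn by (simp add: sum_nonneg)
        hence k: "0 < k" using g sum by linarith
        have "(\<Sum>i<n. \<beta>' i) \<le> int (k - 1)" using g sum k by linarith
        moreover have le: "\<forall>i<n. \<beta>' i \<le> d i \<and> \<gamma> i \<le> d i"
        proof (intro allI impI)
          fix i assume "i < n"
          hence "\<beta>' i + \<gamma> i \<le> d i" using \<beta>(2) snoc by auto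
          moreover have "0 \<le> \<beta>' i" "0 \<le> \<gamma> i" using nn pos_real_roots_props(2)[OF \<gamma>] by blast+
          ultimately show "\<beta>' i \<le> d i \<and> \<gamma> i \<le> d i" by linarith
        qed
        ultimately have "v' \<in> S (k - 1)"
          unfolding S_def using snoc(2) by (intro CollectI exI[of _ \<beta>'] conjI) simp_all
        moreover have "\<gamma> \<in> R"
          unfolding R_def using \<gamma> le by simp
        ultimately show ?thesis using v' k by blast
      qed simp
    qed
    show "S k \<subseteq> {u} \<union> (\<Union>\<gamma>\<in>R. (\<lambda>v. v \<odot> reflection n \<gamma>) ` S (k - 1))"
      using *[of _ k] by blast
    show "S 0 \<subseteq> {u}" using *[of _ 0] by blast
  qed
  have S: "finite (S k)" for k
  proof (induction k)
    case 0
    thus ?case using zero by (rule finite_subset) simp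
  next
    case (Suc k)
    thus ?case using R by (intro finite_subset[OF step]) simp
  qed
  have "{v. \<exists>\<beta>. moment_chain n u v \<beta> \<and> (\<forall>i<n. \<beta> i \<le> d i)} \<subseteq> S (nat D)"
  proof (intro subsetI, unfold mem_Collect_eq, elim exE conjE)
    fix v \<beta> assume \<beta>: "moment_chain n u v \<beta>" "\<forall>i<n. \<beta> i \<le> d i"
    have "(\<Sum>i<n. \<beta> i) \<le> D"
      unfolding D_def using \<beta>(2) by (intro sum_mono) (meson abs_ge_self lessThan_iff order_trans)
    thus "v \<in> S (nat D)" using \<beta> by (auto simp: S_def)
  qed
  thus ?thesis using S by (rule finite_subset)
qed

section \<open>Maximal elements and cofinal subsets\<close>

text \<open>An element of greatest length among those above \<open>z\<close> is maximal, as Bruhat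
  order strictly increases length between distinct elements.\<close>

lemma bruhat_max_above:
  assumes "finite X" "z \<in> X"
  obtains m where "m \<in> bruhat_max n X" "z \<preceq> m"
proof -
  define Y where "Y = {x \<in> X. z \<preceq> x}"
  have Y: "finite Y" "z \<in> Y" using assms bruhat_le_refl by (auto simp: Y_def)
  obtain m where m: "m \<in> Y" "len m = Max (len ` Y)"
    using obtains_MAX[OF Y(1), of len] Y(2) by (metis empty_iff)
  have "m \<in> bruhat_max n X"
    unfolding bruhat_max_def
  proof (intro CollectI conjI ballI impI)
    show "m \<in> X" using m by (simp add: Y_def)
  next
    fix x assume x: "x \<in> X" "m \<preceq> x"
    hence "x \<in> Y" using m(1) bruhat_le_trans by (auto simp: Y_def)
    hence "len x \<le> len m" using m(2) Y(1) by simp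
    thus "x = m" using bruhat_le_len[OF x(2)] by auto
  qed
  thus thesis using that m(1) by (simp add: Y_def)
qed

text \<open>Reduces the theorem to two checks: the Hecke products are reachable from below
  \<open>w\<close>, and they dominate everything that is.\<close>

lemma bruhat_max_cofinal:
  assumes "A \<subseteq> X" "\<And>x. x \<in> X \<Longrightarrow> \<exists>a\<in>A. x \<preceq> a"
  shows "bruhat_max n X = bruhat_max n A"
proof (intro equalityI subsetI)
  fix v assume v: "v \<in> bruhat_max n X"
  then obtain a where "a \<in> A" "v \<preceq> a" using assms(2) by (auto simp: bruhat_max_def)
  moreover from this have "a = v" using v assms(1) by (auto simp: bruhat_max_def)
  ultimately show "v \<in> bruhat_max n A" using v assms(1) by (auto simp: bruhat_max_def)
next
  fix v assume v: "v \<in> bruhat_max n A"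
  have "x = v" if x: "x \<in> X" "v \<preceq> x" for x
  proof -
    obtain a where a: "a \<in> A" "x \<preceq> a" using assms(2) x by blast
    hence "a = v" using v bruhat_le_trans[OF x(2) a(2)] by (simp add: bruhat_max_def)
    thus ?thesis using a x bruhat_le_antisym by blast
  qed
  thus "v \<in> bruhat_max n X" using v assms(1) by (auto simp: bruhat_max_def)
qed

end

theorem theorem1p4:
  fixes n :: nat
    and w :: "lattice_elt \<Rightarrow> lattice_elt"
    and d :: lattice_elt
  assumes "n \<ge> 3"
    and "w \<in> carrier (weyl_group n)"
    and "d \<in> degrees n"
  shows "curve_nbhd n d w =
           bruhat_max n {hecke n w u | u. u \<in> curve_nbhd n d \<one>\<^bsub>weyl_group n\<^esub>}"
proof -
  interpret affine_weyl_group n by unfold_locales (rule assms(1))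
  define X where "X w = {v \<in> W. \<exists>u'\<in>W. u' \<preceq> w \<and>
    (\<exists>\<beta>. moment_chain n u' v \<beta> \<and> (\<forall>i<n. \<beta> i \<le> d i))}" for w
  have nbhd: "curve_nbhd n d w = bruhat_max n (X w)" for w
    by (simp add: curve_nbhd_def X_def)
  \<comment> \<open>The identity is the only element below itself, so its neighborhood involves only
    chains that start there.\<close>
  have X1: "X e = {v \<in> W. \<exists>\<beta>. moment_chain n e v \<beta> \<and> (\<forall>i<n. \<beta> i \<le> d i)}"
    by (auto simp: X_def bruhat_le_one)
  have fin: "finite (X e)"
    unfolding X1 by (rule finite_subset[OF _ finite_chain_targets[of e d]]) blast
  have "bruhat_max n (X w) = bruhat_max n {hecke n w u | u. u \<in> bruhat_max n (X e)}"
  proof (rule bruhat_max_cofinal)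
    show "{hecke n w u | u. u \<in> bruhat_max n (X e)} \<subseteq> X w"
    proof (clarsimp simp: bruhat_max_def)
      fix u assume "u \<in> X e"
      then obtain \<beta> where u: "u \<in> W" "moment_chain n e u \<beta>" "\<forall>i<n. \<beta> i \<le> d i"
        by (auto simp: X1)
      obtain x where x: "x \<in> W" "x \<preceq> w" "hecke n w u = x \<odot> u"
        using hecke_factor[OF assms(2) u(1)] .
      \<comment> \<open>Translating the chain from the identity by \<open>x\<close> gives a chain of
        the same degree that starts below \<open>w\<close> and ends at the Hecke product.\<close>
      have "moment_chain n x (x \<odot> u) \<beta>"
        using moment_chain_left_mult[OF u(2) x(1)] x(1) by simp
      thus "hecke n w u \<in> X w" using x u by (auto simp: X_def)
    qed
  next
    fix v assume "v \<in> X w"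
    then obtain u' \<beta> where v: "v \<in> W" "u' \<in> W" "u' \<preceq> w" "moment_chain n u' v \<beta>"
      "\<forall>i<n. \<beta> i \<le> d i" by (auto simp: X_def)
    \<comment> \<open>Translating the chain back to start at the identity turns its endpoint
      \<open>v\<close> into \<open>z\<close>.\<close>
    define z where "z = inv\<^bsub>weyl_group n\<^esub> u' \<odot> v"
    have vz: "v = u' \<odot> z" and zW: "z \<in> W"
      using v by (simp_all add: z_def flip: weyl.m_assoc)
    have "moment_chain n e z \<beta>"
      using moment_chain_left_mult[OF v(4), of "inv\<^bsub>weyl_group n\<^esub> u'"] v by (simp add: z_def)
    hence "z \<in> X e" using zW v by (auto simp: X1)
    then obtain m where m: "m \<in> bruhat_max n (X e)" "z \<preceq> m"
      using bruhat_max_above[OF fin] by blast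
    have "m \<in> W" using m by (auto simp: bruhat_max_def X_def)
    hence "v \<preceq> hecke n w m" unfolding vz using mult_le_hecke v m assms(2) by blast
    thus "\<exists>a\<in>{hecke n w u | u. u \<in> bruhat_max n (X e)}. v \<preceq> a" using m by blast
  qed
  thus ?thesis by (simp add: nbhd)
qed

end
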